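(* Let $\mathbf D$ be a double Boolean algebra and let $(A,B)$ be a pair of subsets $A\subseteq\mathcal F_{pr}(\mathbf D)$, $B\subseteq\mathcal I_{pr}(\mathbf D)$. Then $(A,B)\in\mathfrak R^T(\mathbb K^T_{pr}(\mathbf D))_p$ if and only if $(A,B)=(F_{\neg x},I_x)$ for some $x\in D_p$. Moreover, if $(A,B)\in\mathfrak R^T(\mathbb K^T_{pr}(\mathbf D))_\sqcap$ then such $x$ can be taken in $D_\sqcap$, and if $(A,B)\in\mathfrak R^T(\mathbb K^T_{pr}(\mathbf D))_\sqcup$ then such $x$ can be taken in $D_\sqcup$.
   Context: A double Boolean algebra (dBa) is an algebra $\mathbf{D}=(D,\sqcup,\sqcap,\neg,\lrcorner,\top,\bot)$ of type $(2,2,1,1,0,0)$ such that, with $x\vee y:=\neg(\neg x\sqcap\neg y)$ and $x\wedge y:=\lrcorner(\lrcorner x\sqcup\lrcorner y)$, for all $x,y,z\in D$: $(x\sqcap x)\sqcap y=x\sqcap y$; $x\sqcap y=y\sqcap x$; $x\sqcap(y\sqcap z)=(x\sqcap y)\sqcap z$; $\neg(x\sqcap x)=\neg x$; $x\sqcap(x\sqcup y)=x\sqcap x$; $x\sqcap(y\vee z)=(x\sqcap y)\vee(x\sqcap z)$; $x\sqcap(x\vee y)=x\sqcap x$; $\neg\neg(x\sqcap y)=x\sqcap y$; $x\sqcap\neg x=\bot$; $\neg\bot=\top\sqcap\top$; $\neg\top=\bot$; the duals $(x\sqcup x)\sqcup y=x\sqcup y$; $x\sqcup y=y\sqcup x$;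 $x\sqcup(y\sqcup z)=(x\sqcup y)\sqcup z$; $\lrcorner(x\sqcup x)=\lrcorner x$; $x\sqcup(x\sqcap y)=x\sqcup x$; $x\sqcup(y\wedge z)=(x\sqcup y)\wedge(x\sqcup z)$; $x\sqcup(x\wedge y)=x\sqcup x$; $\lrcorner\lrcorner(x\sqcup y)=x\sqcup y$; $x\sqcup\lrcorner x=\top$; $\lrcorner\top=\bot\sqcup\bot$; $\lrcorner\bot=\top$; and $(x\sqcap x)\sqcup(x\sqcap x)=(x\sqcup x)\sqcap(x\sqcup x)$. The quasi-order: $x\sqsubseteq y$ iff $x\sqcap y=x\sqcap x$ and $x\sqcup y=y\sqcup y$. For any algebra $\mathbf E$ with these operations, $E_\sqcap:=\{e:e\sqcap e=e\}$, $E_\sqcup:=\{e:e\sqcup e=e\}$, $E_p:=E_\sqcap\cup E_\sqcup$. A filter of $\mathbf D$ is $F\subseteq D$ closed under $\sqcap$ and upward closed; an ideal is $I\subseteq D$ closed under $\sqcup$ and downward closed. Primary filter: filter $F\ne D$ with $x\in F$ or $\neg x\in F$ for all $x$; primary ideal: ideal $I\ne D$ with $x\in I$ or $\lrcorner x\in I$ for all $x$. $\mathcal F_{pr}(\mathbf D)$, $\mathcal I_{pr}(\mathbf D)$ are their sets; $F_x:=\{F\in\mathcal F_{pr}(\mathbf D):x\in F\}$, $I_x:=\{I\in\mathcal I_{pr}(\mathbf D):x\in I\}$; $\mathcal T$, $\mathcal J$ are the topologies with $\{F_x\}$, $\{I_x\}$ as subbases of closed sets; $\mathbb K^T_{pr}(\mathbf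 D):=((\mathcal F_{pr}(\mathbf D),\mathcal T),(\mathcal I_{pr}(\mathbf D),\mathcal J),\nabla)$, $F\nabla I$ iff $F\cap I=\emptyset$. For a relation $R\subseteq G\times M$, $A\subseteq G$, $B\subseteq M$: $A^{\blacksquare}:=\{m:R^{-1}(m)\subseteq A\}$, $B^{\lozenge}:=\{g:R(g)\cap B\ne\emptyset\}$. An object oriented protoconcept is a pair $(A,B)$ with $A^{\blacksquare\lozenge}=B^{\lozenge}$. $\mathfrak R^T(\mathbb K^T)$ is the set of object oriented protoconcepts with $A$ clopen in $G$ and $B$ clopen in $M$, with operations $(A,B)\sqcap(C,D)=(A\cup C,(A\cup C)^{\blacksquare})$, $(A,B)\sqcup(C,D)=((B\cap D)^{\lozenge},B\cap D)$, $\neg(A,B)=(A^c,A^{c\blacksquare})$, $\lrcorner(A,B)=(B^{c\lozenge},B^c)$, $\top=(\emptyset,\emptyset)$, $\bot=(G,M)$; thus $\mathfrak R^T(\mathbb K^T)_\sqcap=\{(A,B):(A,B)=(A,A^{\blacksquare})\}$, $\mathfrak R^T(\mathbb K^T)_\sqcup=\{(A,B):(A,B)=(B^\lozenge,B)\}$ within $\mathfrak R^T(\mathbb K^T)$. *)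

theory Defs
  imports "HOL-Algebra.Congruence" "HOL-Analysis.Abstract_Topology"
begin

(* dneg and dopp are the two negations of a double Boolean algebra, usually written
   with a negation sign (for the meet part) and a lower right corner (for the join part). *)
record 'a dba_alg = "'a partial_object" +
  djoin :: "'a \<Rightarrow> 'a \<Rightarrow> 'a"  (infixl \<open>\<squnion>\<index>\<close> 65)
  dmeet :: "'a \<Rightarrow> 'a \<Rightarrow> 'a"  (infixl \<open>\<sqinter>\<index>\<close> 70)
  dneg  :: "'a \<Rightarrow> 'a"  (\<open>\<sim>\<index> _\<close> [81] 80)
  dopp  :: "'a \<Rightarrow> 'a"  (\<open>\<rfloor>\<index> _\<close> [81] 80)
  dtop  :: 'a  (\<open>\<top>\<index>\<close>)
  dbot  :: 'a  (\<open>\<bottom>\<index>\<close>)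

definition dvee :: "('a, 'b) dba_alg_scheme \<Rightarrow> 'a \<Rightarrow> 'a \<Rightarrow> 'a"  (infixl \<open>\<curlyvee>\<index>\<close> 65)
  where "x \<curlyvee>\<^bsub>D\<^esub> y = \<sim>\<^bsub>D\<^esub> (\<sim>\<^bsub>D\<^esub> x \<sqinter>\<^bsub>D\<^esub> \<sim>\<^bsub>D\<^esub> y)"

definition dwedge :: "('a, 'b) dba_alg_scheme \<Rightarrow> 'a \<Rightarrow> 'a \<Rightarrow> 'a"  (infixl \<open>\<curlywedge>\<index>\<close> 70)
  where "x \<curlywedge>\<^bsub>D\<^esub> y = \<rfloor>\<^bsub>D\<^esub> (\<rfloor>\<^bsub>D\<^esub> x \<squnion>\<^bsub>D\<^esub> \<rfloor>\<^bsub>D\<^esub> y)"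

locale double_boolean_algebra =
  fixes D :: "('a, 'b) dba_alg_scheme" (structure)
  assumes join_closed: "\<lbrakk>x \<in> carrier D; y \<in> carrier D\<rbrakk> \<Longrightarrow> x \<squnion> y \<in> carrier D"
    and meet_closed: "\<lbrakk>x \<in> carrier D; y \<in> carrier D\<rbrakk> \<Longrightarrow> x \<sqinter> y \<in> carrier D"
    and neg_closed: "x \<in> carrier D \<Longrightarrow> \<sim> x \<in> carrier D"
    and opp_closed: "x \<in> carrier D \<Longrightarrow> \<rfloor> x \<in> carrier D"
    and top_closed: "\<top> \<in> carrier D"
    and bot_closed: "\<bottom> \<in> carrier D"
    and meet_idem_left: "\<lbrakk>x \<in> carrier D; y \<in> carrier D\<rbrakk> \<Longrightarrow> (x \<sqinter> x) \<sqinter> y = x \<sqinter> y"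
    and meet_comm: "\<lbrakk>x \<in> carrier D; y \<in> carrier D\<rbrakk> \<Longrightarrow> x \<sqinter> y = y \<sqinter> x"
    and meet_assoc: "\<lbrakk>x \<in> carrier D; y \<in> carrier D; z \<in> carrier D\<rbrakk>
      \<Longrightarrow> x \<sqinter> (y \<sqinter> z) = (x \<sqinter> y) \<sqinter> z"
    and neg_meet_idem: "x \<in> carrier D \<Longrightarrow> \<sim> (x \<sqinter> x) = \<sim> x"
    and meet_join_absorb: "\<lbrakk>x \<in> carrier D; y \<in> carrier D\<rbrakk> \<Longrightarrow> x \<sqinter> (x \<squnion> y) = x \<sqinter> x"
    and meet_vee_distrib: "\<lbrakk>x \<in> carrier D; y \<in> carrier D; z \<in> carrier D\<rbrakk>
      \<Longrightarrow> x \<sqinter> (y \<curlyvee> z) = (x \<sqinter> y) \<curlyvee> (x \<sqinter> z)"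
    and meet_vee_absorb: "\<lbrakk>x \<in> carrier D; y \<in> carrier D\<rbrakk> \<Longrightarrow> x \<sqinter> (x \<curlyvee> y) = x \<sqinter> x"
    and neg_neg_meet: "\<lbrakk>x \<in> carrier D; y \<in> carrier D\<rbrakk> \<Longrightarrow> \<sim> (\<sim> (x \<sqinter> y)) = x \<sqinter> y"
    and meet_neg: "x \<in> carrier D \<Longrightarrow> x \<sqinter> \<sim> x = \<bottom>"
    and neg_bot: "\<sim> \<bottom> = \<top> \<sqinter> \<top>"
    and neg_top: "\<sim> \<top> = \<bottom>"
    and join_idem_left: "\<lbrakk>x \<in> carrier D; y \<in> carrier D\<rbrakk> \<Longrightarrow> (x \<squnion> x) \<squnion> y = x \<squnion> y"
    and join_comm: "\<lbrakk>x \<in> carrier D; y \<in> carrier D\<rbrakk> \<Longrightarrow> x \<squnion> y = y \<squnion> x"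
    and join_assoc: "\<lbrakk>x \<in> carrier D; y \<in> carrier D; z \<in> carrier D\<rbrakk>
      \<Longrightarrow> x \<squnion> (y \<squnion> z) = (x \<squnion> y) \<squnion> z"
    and opp_join_idem: "x \<in> carrier D \<Longrightarrow> \<rfloor> (x \<squnion> x) = \<rfloor> x"
    and join_meet_absorb: "\<lbrakk>x \<in> carrier D; y \<in> carrier D\<rbrakk> \<Longrightarrow> x \<squnion> (x \<sqinter> y) = x \<squnion> x"
    and join_wedge_distrib: "\<lbrakk>x \<in> carrier D; y \<in> carrier D; z \<in> carrier D\<rbrakk>
      \<Longrightarrow> x \<squnion> (y \<curlywedge> z) = (x \<squnion> y) \<curlywedge> (x \<squnion> z)"
    and join_wedge_absorb: "\<lbrakk>x \<in> carrier D; y \<in> carrier D\<rbrakk> \<Longrightarrow> x \<squnion> (x \<curlywedge> y) = x \<squnion> x"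
    and opp_opp_join: "\<lbrakk>x \<in> carrier D; y \<in> carrier D\<rbrakk> \<Longrightarrow> \<rfloor> (\<rfloor> (x \<squnion> y)) = x \<squnion> y"
    and join_opp: "x \<in> carrier D \<Longrightarrow> x \<squnion> \<rfloor> x = \<top>"
    and opp_top: "\<rfloor> \<top> = \<bottom> \<squnion> \<bottom>"
    and opp_bot: "\<rfloor> \<bottom> = \<top>"
    and meet_join_idem: "x \<in> carrier D
      \<Longrightarrow> (x \<sqinter> x) \<squnion> (x \<sqinter> x) = (x \<squnion> x) \<sqinter> (x \<squnion> x)"

definition dle :: "('a, 'b) dba_alg_scheme \<Rightarrow> 'a \<Rightarrow> 'a \<Rightarrow> bool"  (infix \<open>\<sqsubseteq>\<index>\<close> 50)
  where "x \<sqsubseteq>\<^bsub>D\<^esub> y \<longleftrightarrow> x \<sqinter>\<^bsub>D\<^esub> y = x \<sqinter>\<^bsub>D\<^esub> x \<and> x \<squnion>\<^bsub>D\<^esub> y = y \<squnion>\<^bsub>D\<^esub> y"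

definition meet_part :: "('a, 'b) dba_alg_scheme \<Rightarrow> 'a set"
  where "meet_part E = {e \<in> carrier E. e \<sqinter>\<^bsub>E\<^esub> e = e}"

definition join_part :: "('a, 'b) dba_alg_scheme \<Rightarrow> 'a set"
  where "join_part E = {e \<in> carrier E. e \<squnion>\<^bsub>E\<^esub> e = e}"

definition pure_part :: "('a, 'b) dba_alg_scheme \<Rightarrow> 'a set"
  where "pure_part E = meet_part E \<union> join_part E"

definition dba_filter :: "('a, 'b) dba_alg_scheme \<Rightarrow> 'a set \<Rightarrow> bool"
  where "dba_filter D F \<longleftrightarrow> F \<subseteq> carrier D \<and>
    (\<forall>x\<in>F. \<forall>y\<in>F. x \<sqinter>\<^bsub>D\<^esub> y \<in> F) \<and>
    (\<forall>x\<in>F. \<forall>y\<in>carrier D. x \<sqsubseteq>\<^bsub>D\<^esub> y \<longrightarrow> y \<in> F)"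

definition dba_ideal :: "('a, 'b) dba_alg_scheme \<Rightarrow> 'a set \<Rightarrow> bool"
  where "dba_ideal D I \<longleftrightarrow> I \<subseteq> carrier D \<and>
    (\<forall>x\<in>I. \<forall>y\<in>I. x \<squnion>\<^bsub>D\<^esub> y \<in> I) \<and>
    (\<forall>x\<in>I. \<forall>y\<in>carrier D. y \<sqsubseteq>\<^bsub>D\<^esub> x \<longrightarrow> y \<in> I)"

definition primary_filters :: "('a, 'b) dba_alg_scheme \<Rightarrow> 'a set set"
  where "primary_filters D =
    {F. dba_filter D F \<and> F \<noteq> carrier D \<and> (\<forall>x\<in>carrier D. x \<in> F \<or> \<sim>\<^bsub>D\<^esub> x \<in> F)}"

definition primary_ideals :: "('a, 'b) dba_alg_scheme \<Rightarrow> 'a set set"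
  where "primary_ideals D =
    {I. dba_ideal D I \<and> I \<noteq> carrier D \<and> (\<forall>x\<in>carrier D. x \<in> I \<or> \<rfloor>\<^bsub>D\<^esub> x \<in> I)}"

definition filters_at :: "('a, 'b) dba_alg_scheme \<Rightarrow> 'a \<Rightarrow> 'a set set"
  where "filters_at D x = {F \<in> primary_filters D. x \<in> F}"

definition ideals_at :: "('a, 'b) dba_alg_scheme \<Rightarrow> 'a \<Rightarrow> 'a set set"
  where "ideals_at D x = {I \<in> primary_ideals D. x \<in> I}"

(* The sets in \<C> form a subbase of closed sets: their complements in U are a subbase of
   open sets.  relative_to U makes U itself open even when \<C> has nonempty intersection. *)
definition closed_subbase_topology :: "'a set \<Rightarrow> 'a set set \<Rightarrow> 'a topology"
  where "closed_subbase_topology U \<C> =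
    topology (arbitrary union_of
      (finite intersection_of (\<lambda>S. S \<in> (\<lambda>C. U - C) ` \<C>) relative_to U))"

lemma topspace_closed_subbase_topology [simp]: "topspace (closed_subbase_topology U \<C>) = U"
  unfolding closed_subbase_topology_def by (rule topspace_subbase)

record ('g, 'm) top_context =
  objects :: "'g topology"
  attributes :: "'m topology"
  incidence :: "('g \<times> 'm) set"

definition primary_context :: "('a, 'b) dba_alg_scheme \<Rightarrow> ('a set, 'a set) top_context"
  where "primary_context D =
    \<lparr>objects = closed_subbase_topology (primary_filters D) (filters_at D ` carrier D),
     attributes = closed_subbase_topology (primary_ideals D) (ideals_at D ` carrier D),
     incidence = {(F, I). F \<in> primary_filters D \<and> I \<in> primary_ideals D \<and> F \<inter> I = {}}\<rparr>"

definition box :: "('g, 'm) top_context \<Rightarrow> 'g set \<Rightarrow> 'm set"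
  where "box K A = {m \<in> topspace (attributes K). (incidence K)\<inverse> `` {m} \<subseteq> A}"

definition dia :: "('g, 'm) top_context \<Rightarrow> 'm set \<Rightarrow> 'g set"
  where "dia K B = {g \<in> topspace (objects K). incidence K `` {g} \<inter> B \<noteq> {}}"

definition oo_protoconcept :: "('g, 'm) top_context \<Rightarrow> 'g set \<times> 'm set \<Rightarrow> bool"
  where "oo_protoconcept K = (\<lambda>(A, B). A \<subseteq> topspace (objects K) \<and>
    B \<subseteq> topspace (attributes K) \<and> dia K (box K A) = dia K B)"

definition clopenin :: "'a topology \<Rightarrow> 'a set \<Rightarrow> bool"
  where "clopenin X S \<longleftrightarrow> openin X S \<and> closedin X S"

definition clopen_oo_protoconcepts ::
    "('g, 'm) top_context \<Rightarrow> ('g set \<times> 'm set) dba_alg"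
  where "clopen_oo_protoconcepts K = (let G = topspace (objects K); M = topspace (attributes K) in
    \<lparr>carrier = {(A, B). oo_protoconcept K (A, B) \<and>
       clopenin (objects K) A \<and> clopenin (attributes K) B},
     djoin = (\<lambda>(A, B) (C, D). (dia K (B \<inter> D), B \<inter> D)),
     dmeet = (\<lambda>(A, B) (C, D). (A \<union> C, box K (A \<union> C))),
     dneg = (\<lambda>(A, B). (G - A, box K (G - A))),
     dopp = (\<lambda>(A, B). (dia K (M - B), M - B)),
     dtop = ({}, {}),
     dbot = (G, M)\<rparr>)"

lemma meet_part_clopen_oo_protoconcepts:
  "meet_part (clopen_oo_protoconcepts K) =
     {(A, B) \<in> carrier (clopen_oo_protoconcepts K). (A, B) = (A, box K A)}"
  by (auto simp: meet_part_def clopen_oo_protoconcepts_def Let_def)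

lemma join_part_clopen_oo_protoconcepts:
  "join_part (clopen_oo_protoconcepts K) =
     {(A, B) \<in> carrier (clopen_oo_protoconcepts K). (A, B) = (dia K B, B)}"
  by (auto simp: join_part_def clopen_oo_protoconcepts_def Let_def)

end

theory Submission imports Defs begin

text \<open>
  Filters only see the \<open>(\<sqinter>, \<sim>)\<close>-reduct: primary filters are the ultrafilters of the Boolean
  algebra of meet-idempotents, and dually for ideals. A Zorn argument separates a filter from a
  set closed under \<open>\<curlyvee>\<close> by a primary filter. This makes the space of primary filters compact, so
  that its clopen sets are exactly the \<open>F\<^sub>z\<close> with \<open>z\<close> meet-idempotent; applied to a primary ideal
  \<open>I\<close> and a meet-idempotent \<open>x \<notin> I\<close>, it yields a primary filter through \<open>x\<close> disjoint from \<open>I\<close>, which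
  identifies the box of \<open>F\<^sub>\<not>\<^sub>x\<close> with \<open>I\<^sub>x\<close>. Exchanging the roles of meet and
  join gives the statements about ideals.
\<close>

section \<open>Duality\<close>

definition dual_dba :: "('a, 'b) dba_alg_scheme \<Rightarrow> 'a dba_alg"
  where "dual_dba D = \<lparr>carrier = carrier D, djoin = dmeet D, dmeet = djoin D,
    dneg = dopp D, dopp = dneg D, dtop = dbot D, dbot = dtop D\<rparr>"

lemma dual_dba_simps [simp]:
  "carrier (dual_dba D) = carrier D" "djoin (dual_dba D) = dmeet D"
  "dmeet (dual_dba D) = djoin D" "dneg (dual_dba D) = dopp D" "dopp (dual_dba D) = dneg D"
  "dtop (dual_dba D) = dbot D" "dbot (dual_dba D) = dtop D"
  by (simp_all add: dual_dba_def)

lemma dvee_dual_dba [simp]: "dvee (dual_dba D) = dwedge D"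
  and dwedge_dual_dba [simp]: "dwedge (dual_dba D) = dvee D"
  by (simp_all add: fun_eq_iff dvee_def dwedge_def)

lemma meet_part_dual_dba: "meet_part (dual_dba D) = join_part D"
  by (simp add: meet_part_def join_part_def)

section \<open>Topologies generated by closed sets\<close>

lemma openin_closed_subbase_topologyE:
  assumes "openin (closed_subbase_topology U \<C>) S" "p \<in> S"
  obtains \<F> where "finite \<F>" "\<F> \<subseteq> \<C>" "p \<in> U" "p \<notin> \<Union>\<F>" "U - \<Union>\<F> \<subseteq> S"
proof -
  let ?B = "finite intersection_of (\<lambda>S. S \<in> (\<lambda>C. U - C) ` \<C>) relative_to U"
  have "(arbitrary union_of ?B) S"
    using assms(1) istopology_subbase unfolding closed_subbase_topology_def
    by (metis topology_inverse')
  then obtain V where "?B V" "p \<in> V" "V \<subseteq> S"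
    using assms(2) unfolding union_of_def by blast
  \<comment> \<open>\<open>\<V>\<close> may be empty; \<open>relative_to\<close> supplies the factor
    \<open>U\<close>, so the basic set is then the whole space.\<close>
  then obtain \<V> where \<V>: "finite \<V>" "\<V> \<subseteq> (\<lambda>C. U - C) ` \<C>" "V = U \<inter> \<Inter>\<V>"
    unfolding relative_to_def intersection_of_def by blast
  then obtain \<F> where "finite \<F>" "\<F> \<subseteq> \<C>" "\<V> = (\<lambda>C. U - C) ` \<F>"
    by (meson finite_subset_image)
  with \<V> \<open>p \<in> V\<close> \<open>V \<subseteq> S\<close> show thesis
    by (intro that[of \<F>]) (auto split: if_splits)
qed

lemma closedin_closed_subbase_topology:
  assumes "C \<in> \<C>" "C \<subseteq> U"
  shows "closedin (closed_subbase_topology U \<C>) C"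
proof -
  let ?P = "\<lambda>S. S \<in> (\<lambda>C. U - C) ` \<C>"
  have "(finite intersection_of ?P relative_to U) (U - C)"
    unfolding relative_to_def intersection_of_def using assms(1)
    by (intro exI[of _ "U - C"] conjI exI[of _ "{U - C}"]) auto
  then have "openin (closed_subbase_topology U \<C>) (U - C)"
    unfolding closed_subbase_topology_def
    by (metis istopology_subbase topology_inverse' arbitrary_union_of_inc)
  with assms(2) show ?thesis by (simp add: closedin_def)
qed

text \<open>On subsets of the two spaces \<open>dia K\<close> is left adjoint to
  \<open>box K\<close>; this is a triangle identity of that adjunction.\<close>

lemma dia_box_dia:
  assumes "Domain (incidence K) \<subseteq> topspace (objects K)"
    and "Range (incidence K) \<subseteq> topspace (attributes K)"
  shows "dia K (box K (dia K B)) = dia K B"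
  using assms unfolding dia_def box_def by blast

section \<open>Laws of the meet reduct\<close>

context double_boolean_algebra
begin

lemmas closed [simp] = join_closed meet_closed neg_closed opp_closed top_closed bot_closed

lemma vee_closed [simp]: "\<lbrakk>x \<in> carrier D; y \<in> carrier D\<rbrakk> \<Longrightarrow> x \<curlyvee> y \<in> carrier D"
  by (simp add: dvee_def)

text \<open>Each axiom is proved by its mirror image; the last one is its own mirror image with the
  two sides swapped.\<close>

lemma dual: "double_boolean_algebra (dual_dba D)"
  by (unfold_locales; simp only: dual_dba_simps dvee_dual_dba dwedge_dual_dba;
      rule closed meet_idem_left meet_comm meet_assoc neg_meet_idem meet_join_absorb
        meet_vee_distrib meet_vee_absorb neg_neg_meet meet_neg neg_bot neg_top join_idem_left
        join_comm join_assoc opp_join_idem join_meet_absorb join_wedge_distrib join_wedge_absorb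
        opp_opp_join join_opp opp_top opp_bot meet_join_idem[symmetric]; assumption)

lemma meet_idem_right: "\<lbrakk>x \<in> carrier D; y \<in> carrier D\<rbrakk> \<Longrightarrow> x \<sqinter> (y \<sqinter> y) = x \<sqinter> y"
  by (metis meet_comm meet_idem_left meet_closed)

lemma meet_meet_self: "\<lbrakk>x \<in> carrier D; y \<in> carrier D\<rbrakk> \<Longrightarrow> (x \<sqinter> y) \<sqinter> (x \<sqinter> y) = x \<sqinter> y"
  by (metis meet_assoc meet_comm meet_idem_left meet_closed)

lemma neg_neg: "x \<in> carrier D \<Longrightarrow> \<sim> (\<sim> x) = x \<sqinter> x"
  by (metis neg_meet_idem neg_neg_meet)

lemma neg_meet_self: "x \<in> carrier D \<Longrightarrow> \<sim> x \<sqinter> \<sim> x = \<sim> x"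
  by (metis neg_closed neg_meet_idem neg_neg)

lemma vee_meet_self: "\<lbrakk>x \<in> carrier D; y \<in> carrier D\<rbrakk> \<Longrightarrow> (x \<curlyvee> y) \<sqinter> (x \<curlyvee> y) = x \<curlyvee> y"
  by (simp add: dvee_def neg_meet_self)

text \<open>\<open>\<top>\<close> is \<open>x \<squnion> \<rfloor> x\<close>, to which absorption
  applies.\<close>

lemma meet_top: "x \<in> carrier D \<Longrightarrow> x \<sqinter> \<top> = x \<sqinter> x"
  by (metis join_opp meet_join_absorb opp_closed)

lemma vee_neg: "x \<in> carrier D \<Longrightarrow> x \<curlyvee> \<sim> x = \<top> \<sqinter> \<top>"
  by (simp add: dvee_def meet_neg neg_bot)

lemma vee_comm: "\<lbrakk>x \<in> carrier D; y \<in> carrier D\<rbrakk> \<Longrightarrow> x \<curlyvee> y = y \<curlyvee> x"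
  by (simp add: dvee_def meet_comm)

lemma bot_meet: "x \<in> carrier D \<Longrightarrow> \<bottom> \<sqinter> x = \<bottom>"
  by (metis meet_assoc meet_comm meet_idem_right meet_neg neg_closed)

section \<open>The preorder of the meet reduct\<close>

text \<open>The meet half of \<open>\<sqsubseteq>\<close>. It identifies \<open>x\<close> with
  \<open>x \<sqinter> x\<close>; up to its equivalence, \<open>\<sqinter>\<close> and
  \<open>\<curlyvee>\<close> are infimum and supremum.\<close>

definition meet_le :: "'a \<Rightarrow> 'a \<Rightarrow> bool"  (infix \<open>\<preceq>\<close> 50)
  where "x \<preceq> y \<longleftrightarrow> x \<sqinter> y = x \<sqinter> x"

lemma meet_le_refl: "x \<preceq> x"
  by (simp add: meet_le_def)

lemma meet_le_trans:
  assumes "x \<preceq> y" "y \<preceq> z" "x \<in> carrier D" "y \<in> carrier D" "z \<in> carrier D"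
  shows "x \<preceq> z"
proof -
  have "x \<sqinter> z = (x \<sqinter> y) \<sqinter> z"
    using assms meet_idem_left[of x z] by (simp add: meet_le_def)
  also have "\<dots> = x \<sqinter> (y \<sqinter> y)"
    using assms meet_assoc[of x y z] by (simp add: meet_le_def)
  finally show ?thesis using assms by (simp add: meet_le_def meet_idem_right)
qed

lemma meet_le_left: "\<lbrakk>x \<in> carrier D; y \<in> carrier D\<rbrakk> \<Longrightarrow> x \<sqinter> y \<preceq> x"
  using meet_comm[of "x \<sqinter> y" x] meet_assoc[of x x y]
  by (simp add: meet_le_def meet_idem_left meet_meet_self)

lemma meet_le_right: "\<lbrakk>x \<in> carrier D; y \<in> carrier D\<rbrakk> \<Longrightarrow> x \<sqinter> y \<preceq> y"
  using meet_le_left meet_comm by metis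

lemma meet_le_meetI:
  assumes "x \<preceq> y" "x \<preceq> z" "x \<in> carrier D" "y \<in> carrier D" "z \<in> carrier D"
  shows "x \<preceq> y \<sqinter> z"
  using assms by (simp add: meet_le_def meet_assoc meet_idem_left)

lemma meet_le_mono:
  assumes "x \<preceq> y" "x \<in> carrier D" "y \<in> carrier D" "z \<in> carrier D"
  shows "x \<sqinter> z \<preceq> y \<sqinter> z"
proof (rule meet_le_meetI)
  show "x \<sqinter> z \<preceq> y" using assms by (intro meet_le_trans[OF meet_le_left assms(1)]) auto
qed (use assms in \<open>simp_all add: meet_le_right\<close>)

lemma meet_le_vee_left: "\<lbrakk>x \<in> carrier D; y \<in> carrier D\<rbrakk> \<Longrightarrow> x \<preceq> x \<curlyvee> y"
  by (simp add: meet_le_def meet_vee_absorb)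

lemma meet_le_vee_right: "\<lbrakk>x \<in> carrier D; y \<in> carrier D\<rbrakk> \<Longrightarrow> y \<preceq> x \<curlyvee> y"
  using meet_le_vee_left vee_comm by metis

lemma meet_le_join_left: "\<lbrakk>x \<in> carrier D; y \<in> carrier D\<rbrakk> \<Longrightarrow> x \<preceq> x \<squnion> y"
  by (simp add: meet_le_def meet_join_absorb)

lemma meet_le_join_right: "\<lbrakk>x \<in> carrier D; y \<in> carrier D\<rbrakk> \<Longrightarrow> y \<preceq> x \<squnion> y"
  using meet_le_join_left join_comm by metis

text \<open>Meet with \<open>z\<close> distributes over \<open>\<curlyvee>\<close>, and
  \<open>\<curlyvee>\<close> does not see the doubling of its arguments.\<close>

lemma vee_meet_leI:
  assumes "x \<preceq> z" "y \<preceq> z" and c: "x \<in> carrier D" "y \<in> carrier D" "z \<in> carrier D"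
  shows "x \<curlyvee> y \<preceq> z"
proof -
  have "z \<sqinter> (x \<curlyvee> y) = (x \<sqinter> x) \<curlyvee> (y \<sqinter> y)"
    using assms by (simp add: meet_vee_distrib meet_le_def meet_comm[of z])
  also have "\<dots> = x \<curlyvee> y" using c by (simp add: dvee_def neg_meet_idem)
  finally show ?thesis using c by (simp add: meet_le_def vee_meet_self meet_comm[of _ z])
qed

text \<open>The join half comes from \<open>y \<squnion> (y \<sqinter> x) = y \<squnion> y\<close>,
  where \<open>y \<sqinter> x\<close> is \<open>x\<close> by idempotence.\<close>

lemma dle_if_meet_le:
  assumes "x \<preceq> y" "x \<sqinter> x = x" "x \<in> carrier D" "y \<in> carrier D"
  shows "x \<sqsubseteq> y"
  using assms join_meet_absorb[of y x]
  by (simp add: meet_le_def dle_def meet_comm[of y x] join_comm[of y x])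

section \<open>Filters and primary filters\<close>

text \<open>A filter contains \<open>x \<sqinter> x\<close> along with \<open>x\<close>, and for
  this meet-idempotent element \<open>\<preceq>\<close> implies
  \<open>\<sqsubseteq>\<close>.\<close>

lemma dba_filter_iff:
  "dba_filter D F \<longleftrightarrow> F \<subseteq> carrier D \<and> (\<forall>x\<in>F. \<forall>y\<in>F. x \<sqinter> y \<in> F) \<and>
    (\<forall>x\<in>F. \<forall>y\<in>carrier D. x \<preceq> y \<longrightarrow> y \<in> F)" (is "_ \<longleftrightarrow> ?R")
proof
  assume F: "dba_filter D F"
  have "y \<in> F" if x: "x \<in> F" and y: "y \<in> carrier D" and le: "x \<preceq> y" for x y
  proof -
    have "x \<in> carrier D" "x \<sqinter> x \<in> F" using F x by (auto simp: dba_filter_def)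
    moreover have "x \<sqinter> x \<sqsubseteq> y"
      using calculation le y
      by (intro dle_if_meet_le) (auto simp: meet_le_def meet_idem_left meet_idem_right)
    ultimately show ?thesis using F y by (auto simp: dba_filter_def)
  qed
  with F show ?R unfolding dba_filter_def by blast
next
  assume ?R then show "dba_filter D F" unfolding dba_filter_def dle_def meet_le_def by blast
qed

lemma filter_carrier: "dba_filter D F \<Longrightarrow> x \<in> F \<Longrightarrow> x \<in> carrier D"
  and filter_meet: "dba_filter D F \<Longrightarrow> x \<in> F \<Longrightarrow> y \<in> F \<Longrightarrow> x \<sqinter> y \<in> F"
  and filter_up: "dba_filter D F \<Longrightarrow> x \<in> F \<Longrightarrow> x \<preceq> y \<Longrightarrow> y \<in> carrier D \<Longrightarrow> y \<in> F"
  by (auto simp: dba_filter_iff)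

lemma dba_filter_principal:
  assumes "x \<in> carrier D"
  shows "dba_filter D {y \<in> carrier D. x \<preceq> y}"
  unfolding dba_filter_iff
  using assms by (auto intro: meet_le_meetI elim: meet_le_trans)

text \<open>For nonempty \<open>F\<close> this is the filter generated by \<open>F\<close> and
  \<open>x\<close>, the enlargement to be compared with a maximal filter.\<close>

lemma dba_filter_adjoin:
  assumes F: "dba_filter D F" and x: "x \<in> carrier D"
  shows "dba_filter D {y \<in> carrier D. \<exists>f\<in>F. f \<sqinter> x \<preceq> y}" (is "dba_filter D ?G")
  unfolding dba_filter_iff
proof (intro conjI ballI impI)
  fix y z assume "y \<in> ?G" "z \<in> ?G"
  then obtain f g where fg: "f \<in> F" "g \<in> F" "f \<sqinter> x \<preceq> y" "g \<sqinter> x \<preceq> z"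
    and yz: "y \<in> carrier D" "z \<in> carrier D" by auto
  have c: "f \<in> carrier D" "g \<in> carrier D" using fg F filter_carrier by auto
  let ?h = "(f \<sqinter> g) \<sqinter> x"
  have "?h \<preceq> f \<sqinter> x" "?h \<preceq> g \<sqinter> x"
    using c x by (simp_all add: meet_le_mono meet_le_left meet_le_right)
  then have "?h \<preceq> y" "?h \<preceq> z"
    using fg c x yz by (meson meet_le_trans meet_closed)+
  then have "?h \<preceq> y \<sqinter> z" using c x yz by (intro meet_le_meetI) auto
  then show "y \<sqinter> z \<in> ?G" using fg F yz filter_meet by auto
next
  fix y z assume "y \<in> ?G" "z \<in> carrier D" "y \<preceq> z"
  then show "z \<in> ?G"
    using F x filter_carrier by (auto intro!: meet_le_trans[of _ y z])
qed auto

text \<open>\<open>\<bottom>\<close> is least for \<open>\<preceq>\<close>, so a proper filter omits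
  it; primality then puts \<open>\<sim> \<bottom>\<close>, that is
  \<open>\<top> \<sqinter> \<top>\<close>, into \<open>F\<close>.\<close>

lemma primary_filterD:
  assumes "F \<in> primary_filters D"
  shows "dba_filter D F" "\<bottom> \<notin> F" "\<top> \<in> F"
proof -
  show F: "dba_filter D F" using assms by (simp add: primary_filters_def)
  have "\<bottom> \<preceq> x" if "x \<in> carrier D" for x using that by (simp add: meet_le_def bot_meet)
  then have "carrier D \<subseteq> F" if "\<bottom> \<in> F" using filter_up[OF F that] by blast
  then show "\<bottom> \<notin> F" using assms filter_carrier[OF F] by (auto simp: primary_filters_def)
  then have "\<sim> \<bottom> \<in> F" using assms by (auto simp: primary_filters_def)
  then have "\<top> \<sqinter> \<top> \<in> F" by (simp add: neg_bot)
  then show "\<top> \<in> F" by (rule filter_up[OF F]) (simp_all add: meet_le_left)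
qed

lemma primary_filter_neg_iff:
  assumes "F \<in> primary_filters D" "x \<in> carrier D"
  shows "\<sim> x \<in> F \<longleftrightarrow> x \<notin> F"
proof -
  have "x \<notin> F" if "\<sim> x \<in> F"
    using filter_meet[OF primary_filterD(1)[OF assms(1)], of x "\<sim> x"] that
      primary_filterD(2)[OF assms(1)] assms(2) by (auto simp: meet_neg)
  with assms show ?thesis by (auto simp: primary_filters_def)
qed

lemma primary_filter_meet_iff:
  assumes "F \<in> primary_filters D" "x \<in> carrier D" "y \<in> carrier D"
  shows "x \<sqinter> y \<in> F \<longleftrightarrow> x \<in> F \<and> y \<in> F"
proof -
  have F: "dba_filter D F" using assms(1) by (rule primary_filterD)
  show ?thesis
    using assms filter_meet[OF F] filter_up[OF F _ meet_le_left[of x y]]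
      filter_up[OF F _ meet_le_right[of x y]] by blast
qed

lemma primary_filter_vee_iff:
  assumes "F \<in> primary_filters D" "x \<in> carrier D" "y \<in> carrier D"
  shows "x \<curlyvee> y \<in> F \<longleftrightarrow> x \<in> F \<or> y \<in> F"
  using assms by (simp add: dvee_def primary_filter_neg_iff primary_filter_meet_iff)

text \<open>The prime filter theorem, by a filter maximal among those that contain \<open>F0\<close>
  and avoid \<open>J\<close>. Closure under \<open>\<curlyvee>\<close> is the form in which ideals
  of \<open>D\<close> fit, since their downward closure refers to \<open>\<sqsubseteq>\<close> and
  not to the weaker \<open>\<preceq>\<close>.\<close>

theorem primary_filter_separation:
  assumes F0: "dba_filter D F0" "F0 \<noteq> {}"
    and J: "J \<subseteq> carrier D" "J \<noteq> {}" "\<And>x y. x \<in> J \<Longrightarrow> y \<in> J \<Longrightarrow> x \<curlyvee> y \<in> J"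
    and disj: "F0 \<inter> J = {}"
  obtains F where "F \<in> primary_filters D" "F0 \<subseteq> F" "F \<inter> J = {}"
proof -
  let ?\<A> = "{F. dba_filter D F \<and> F0 \<subseteq> F \<and> F \<inter> J = {}}"
  have "\<exists>F\<in>?\<A>. \<forall>G\<in>?\<A>. F \<subseteq> G \<longrightarrow> G = F"
  proof (rule subset_Zorn_nonempty)
    show "?\<A> \<noteq> {}" using F0 disj by auto
    fix \<C> assume \<C>: "\<C> \<noteq> {}" "subset.chain ?\<A> \<C>"
    then have sub: "\<C> \<subseteq> ?\<A>" and chain: "\<And>X Y. X \<in> \<C> \<Longrightarrow> Y \<in> \<C> \<Longrightarrow> X \<subseteq> Y \<or> Y \<subseteq> X"
      by (auto simp: subset_chain_def)
    have "x \<sqinter> y \<in> \<Union>\<C>" if xy: "x \<in> \<Union>\<C>" "y \<in> \<Union>\<C>" for x y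
    proof -
      obtain X where "X \<in> \<C>" "x \<in> X" "y \<in> X" using xy chain by blast
      then show ?thesis using sub filter_meet by blast
    qed
    moreover have "\<Union>\<C> \<subseteq> carrier D" using sub filter_carrier by blast
    moreover have "\<forall>x\<in>\<Union>\<C>. \<forall>y\<in>carrier D. x \<preceq> y \<longrightarrow> y \<in> \<Union>\<C>"
      using sub filter_up by blast
    ultimately have "dba_filter D (\<Union>\<C>)" by (simp add: dba_filter_iff)
    then show "\<Union>\<C> \<in> ?\<A>" using sub \<C>(1) by blast
  qed
  then obtain F where FA: "F \<in> ?\<A>" and mx: "\<forall>G\<in>?\<A>. F \<subseteq> G \<longrightarrow> G = F" ..
  then have F: "dba_filter D F" "F0 \<subseteq> F" "F \<inter> J = {}" by simp_all
  have max: "G = F" if "dba_filter D G" "G \<inter> J = {}" "F \<subseteq> G" for G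
    using mx that F(2) by simp
  \<comment> \<open>By maximality the filter generated by \<open>F\<close> and \<open>x\<close>
    meets \<open>J\<close>. Nonemptiness of \<open>F0\<close> ensures that \<open>x\<close> belongs
    to it.\<close>
  have meets: "\<exists>f\<in>F. \<exists>j\<in>J. f \<sqinter> x \<preceq> j" if x: "x \<in> carrier D" "x \<notin> F" for x
  proof (rule ccontr)
    assume neg: "\<not> ?thesis"
    let ?G = "{y \<in> carrier D. \<exists>f\<in>F. f \<sqinter> x \<preceq> y}"
    have "F \<subseteq> ?G" using filter_carrier[OF F(1)] x meet_le_left by blast
    moreover have "?G \<inter> J = {}" using neg by auto
    ultimately have "?G = F" using max dba_filter_adjoin[OF F(1) x(1)] by blast
    moreover obtain f where "f \<in> F" using F F0 by blast
    then have "x \<in> ?G" using filter_carrier[OF F(1)] x meet_le_right by blast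
    ultimately show False using x by blast
  qed
  have "x \<in> F \<or> \<sim> x \<in> F" if x: "x \<in> carrier D" for x
  proof (rule ccontr)
    assume "\<not> ?thesis"
    then obtain f i g j where fg: "f \<in> F" "i \<in> J" "f \<sqinter> x \<preceq> i" "g \<in> F" "j \<in> J" "g \<sqinter> \<sim> x \<preceq> j"
      using meets[of x] meets[of "\<sim> x"] x by auto
    have c: "f \<in> carrier D" "g \<in> carrier D" "i \<in> carrier D" "j \<in> carrier D"
      using fg F(1) J(1) filter_carrier by auto
    \<comment> \<open>\<open>i \<curlyvee> j\<close> bounds both \<open>?h \<sqinter> x\<close> and
      \<open>?h \<sqinter> \<sim> x\<close>, whose \<open>\<curlyvee>\<close> is
      \<open>?h \<sqinter> ?h\<close>; so it falls into both \<open>F\<close> and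
      \<open>J\<close>.\<close>
    let ?h = "f \<sqinter> g"
    have "?h \<sqinter> x \<preceq> f \<sqinter> x"
      using c x by (simp add: meet_le_mono meet_le_left)
    then have "?h \<sqinter> x \<preceq> i \<curlyvee> j"
      using fg c x meet_le_vee_left by (meson meet_le_trans meet_closed vee_closed)
    moreover have "?h \<sqinter> \<sim> x \<preceq> g \<sqinter> \<sim> x"
      using c x by (simp add: meet_le_mono meet_le_right)
    then have "?h \<sqinter> \<sim> x \<preceq> i \<curlyvee> j"
      using fg c x meet_le_vee_right by (meson meet_le_trans meet_closed vee_closed neg_closed)
    ultimately have "(?h \<sqinter> x) \<curlyvee> (?h \<sqinter> \<sim> x) \<preceq> i \<curlyvee> j"
      using c x by (intro vee_meet_leI) auto
    \<comment> \<open>Distributivity turns the left side into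
      \<open>?h \<sqinter> (\<top> \<sqinter> \<top>)\<close>, which collapses to
      \<open>?h \<sqinter> ?h\<close>.\<close>
    moreover have "(?h \<sqinter> x) \<curlyvee> (?h \<sqinter> \<sim> x) = ?h \<sqinter> ?h"
      using c x meet_vee_distrib[of ?h x "\<sim> x"] meet_idem_right[of ?h "\<top>"] meet_top[of ?h]
      by (simp add: vee_neg)
    moreover have "?h \<sqinter> ?h \<in> F" using fg F(1) filter_meet by blast
    ultimately have "i \<curlyvee> j \<in> F" using c by (auto intro: filter_up[OF F(1)])
    then show False using J(3) fg F(3) by blast
  qed
  moreover have "F \<noteq> carrier D" using F(3) J(1,2) by auto
  ultimately have "F \<in> primary_filters D" using F(1) by (simp add: primary_filters_def)
  then show thesis using that F(2,3) by blast
qed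

section \<open>The space of primary filters\<close>

lemma filters_at_neg:
  "x \<in> carrier D \<Longrightarrow> filters_at D (\<sim> x) = primary_filters D - filters_at D x"
  by (auto simp: filters_at_def primary_filter_neg_iff)

lemma filters_at_meet_self: "x \<in> carrier D \<Longrightarrow> filters_at D (x \<sqinter> x) = filters_at D x"
  by (auto simp: filters_at_def primary_filter_meet_iff)

abbreviation filter_space :: "'a set topology"
  where "filter_space \<equiv> closed_subbase_topology (primary_filters D) (filters_at D ` carrier D)"

text \<open>The sets \<open>filters_at D z\<close> are closed under complement, through
  \<open>\<sim>\<close>, and under intersection, through \<open>\<sqinter>\<close>; so the subbase
  already yields a base of sets of this form.\<close>

lemma filters_at_basis:
  assumes "openin filter_space S" "F \<in> S"
  obtains z where "z \<in> carrier D" "z \<in> F" "filters_at D z \<subseteq> S"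
proof -
  obtain \<F> where \<F>: "finite \<F>" "\<F> \<subseteq> filters_at D ` carrier D" "F \<in> primary_filters D"
    "F \<notin> \<Union>\<F>" "primary_filters D - \<Union>\<F> \<subseteq> S"
    using openin_closed_subbase_topologyE[OF assms] .
  have "\<exists>z\<in>carrier D. primary_filters D - \<Union>\<F> = filters_at D z"
    using \<F>(1,2)
  proof (induction \<F>)
    case empty
    \<comment> \<open>The empty intersection is the whole space, which is
      \<open>filters_at D \<top>\<close>.\<close>
    then show ?case by (auto simp: filters_at_def primary_filterD intro!: bexI[of _ "\<top>"])
  next
    case (insert C \<F>)
    then obtain z x where "z \<in> carrier D" "x \<in> carrier D" "C = filters_at D x"
      "primary_filters D - \<Union>\<F> = filters_at D z" by auto
    moreover from this have "primary_filters D - \<Union>(insert C \<F>) = filters_at D (z \<sqinter> \<sim> x)"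
      by (auto simp: filters_at_def primary_filter_meet_iff primary_filter_neg_iff)
    ultimately show ?case by (auto intro!: bexI[of _ "z \<sqinter> \<sim> x"])
  qed
  then obtain z where "z \<in> carrier D" "primary_filters D - \<Union>\<F> = filters_at D z" by blast
  moreover from this have "F \<in> filters_at D z" using \<F>(3,4) by blast
  ultimately show thesis using that[of z] \<F>(5) by (simp add: filters_at_def)
qed

text \<open>Closed as a subbasic set, and open because its complement is the subbasic closed set of
  \<open>\<sim> x\<close>.\<close>

lemma clopenin_filters_at:
  assumes "x \<in> carrier D"
  shows "clopenin filter_space (filters_at D x)"
proof -
  have sub: "filters_at D y \<subseteq> primary_filters D" for y by (auto simp: filters_at_def)
  have "closedin filter_space (filters_at D y)" if "y \<in> carrier D" for y
    using that sub by (intro closedin_closed_subbase_topology) auto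
  from this[OF assms] this[of "\<sim> x"] assms sub show ?thesis
    by (simp add: clopenin_def filters_at_neg openin_closedin_eq)
qed

text \<open>Compactness in algebraic form: the basic sets inside \<open>A\<close> and inside its
  complement cover the space, and separation reduces this cover to one pair \<open>z\<close>,
  \<open>w\<close> with \<open>\<top> \<preceq> z \<curlyvee> w\<close>.\<close>

lemma clopenin_filter_spaceE:
  assumes "clopenin filter_space A"
  obtains z where "z \<in> meet_part D" "A = filters_at D z"
proof -
  let ?P = "primary_filters D"
  have op: "openin filter_space A" "openin filter_space (?P - A)"
    using assms by (auto simp: clopenin_def closedin_def)
  have A: "A \<subseteq> ?P" using openin_subset[OF op(1)] by simp
  let ?Z = "{z \<in> carrier D. filters_at D z \<subseteq> A}"
  let ?W = "{w \<in> carrier D. filters_at D w \<subseteq> ?P - A}"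
  \<comment> \<open>The \<open>\<preceq>\<close>-ideal generated by \<open>?Z\<close> and
    \<open>?W\<close>. If nothing above \<open>\<top>\<close> lay in it, some primary filter would
    avoid \<open>?Z\<close> and \<open>?W\<close>, against the basis property at that
    filter.\<close>
  let ?J = "{u \<in> carrier D. \<exists>z\<in>?Z. \<exists>w\<in>?W. u \<preceq> z \<curlyvee> w}"
  have bot: "\<bottom> \<in> ?Z" "\<bottom> \<in> ?W" by (auto simp: filters_at_def primary_filterD)
  have "\<exists>u\<in>?J. \<top> \<preceq> u"
  proof (rule ccontr)
    assume neg: "\<not> ?thesis"
    obtain F where F: "F \<in> ?P" "F \<inter> ?J = {}"
    proof (rule primary_filter_separation[OF dba_filter_principal[OF top_closed], of ?J])
      show "{y \<in> carrier D. \<top> \<preceq> y} \<noteq> {}" using meet_le_refl top_closed by blast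
      have "\<bottom> \<in> ?J" using bot meet_le_vee_left by blast
      then show "?J \<noteq> {}" by blast
      show "{y \<in> carrier D. \<top> \<preceq> y} \<inter> ?J = {}" using neg by blast
      fix u v assume "u \<in> ?J" "v \<in> ?J"
      then obtain z w z' w' where h: "z \<in> ?Z" "w \<in> ?W" "z' \<in> ?Z" "w' \<in> ?W"
        "u \<preceq> z \<curlyvee> w" "v \<preceq> z' \<curlyvee> w'" and c: "u \<in> carrier D" "v \<in> carrier D" by blast
      have c': "z \<in> carrier D" "w \<in> carrier D" "z' \<in> carrier D" "w' \<in> carrier D"
        using h by auto
      \<comment> \<open>Regrouped so that the left half belongs to \<open>?Z\<close> and the right
        half to \<open>?W\<close>.\<close>
      let ?s = "(z \<curlyvee> z') \<curlyvee> (w \<curlyvee> w')"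
      have "z \<preceq> ?s" "z' \<preceq> ?s" "w \<preceq> ?s" "w' \<preceq> ?s"
        using c' by (meson meet_le_trans meet_le_vee_left meet_le_vee_right vee_closed)+
      then have "z \<curlyvee> w \<preceq> ?s" "z' \<curlyvee> w' \<preceq> ?s" using c' by (auto intro!: vee_meet_leI)
      then have "u \<preceq> ?s" "v \<preceq> ?s" using h c c' by (meson meet_le_trans vee_closed)+
      then have "u \<curlyvee> v \<preceq> ?s" using c c' by (auto intro!: vee_meet_leI)
      moreover have "z \<curlyvee> z' \<in> ?Z" "w \<curlyvee> w' \<in> ?W"
        using h by (auto simp: filters_at_def primary_filter_vee_iff)
      ultimately show "u \<curlyvee> v \<in> ?J" using c vee_closed by blast
    qed auto
    have "?Z \<subseteq> ?J" "?W \<subseteq> ?J" using bot meet_le_vee_left meet_le_vee_right by blast+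
    moreover have "\<exists>z\<in>?Z \<union> ?W. z \<in> F"
    proof (cases "F \<in> A")
      case True
      then show ?thesis using filters_at_basis[OF op(1)] by blast
    next
      case False
      with F(1) have "F \<in> ?P - A" by simp
      then show ?thesis using filters_at_basis[OF op(2)] by blast
    qed
    ultimately show False using F(2) by blast
  qed
  then obtain u z w where h: "u \<in> carrier D" "z \<in> ?Z" "w \<in> ?W" "\<top> \<preceq> u" "u \<preceq> z \<curlyvee> w"
    by blast
  then have le: "\<top> \<preceq> z \<curlyvee> w" by (blast intro: meet_le_trans top_closed vee_closed)
  have "A \<subseteq> filters_at D z"
  proof
    fix F assume F: "F \<in> A"
    then have FP: "F \<in> ?P" using A by blast
    then have "z \<curlyvee> w \<in> F" using le h primary_filterD[OF FP] filter_up by auto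
    then have "z \<in> F \<or> w \<in> F" using FP h by (simp add: primary_filter_vee_iff)
    \<comment> \<open>\<open>w \<in> F\<close> is impossible, as it would put \<open>F\<close>
      outside \<open>A\<close>.\<close>
    then show "F \<in> filters_at D z" using h F FP by (auto simp: filters_at_def)
  qed
  \<comment> \<open>Doubling \<open>z\<close> makes it meet-idempotent without changing its set of
    filters.\<close>
  then have "A = filters_at D (z \<sqinter> z)" using h by (auto simp: filters_at_meet_self)
  then show thesis using h that[of "z \<sqinter> z"] by (auto simp: meet_part_def meet_meet_self)
qed

section \<open>Ideals as filters of the dual algebra\<close>

lemma dle_dual_dba:
  "\<lbrakk>x \<in> carrier D; y \<in> carrier D\<rbrakk> \<Longrightarrow> x \<sqsubseteq>\<^bsub>dual_dba D\<^esub> y \<longleftrightarrow> y \<sqsubseteq> x"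
  by (auto simp: dle_def meet_comm join_comm)

lemma dba_filter_dual_dba: "dba_filter (dual_dba D) F \<longleftrightarrow> dba_ideal D F"
  unfolding dba_filter_def dba_ideal_def using dle_dual_dba by (auto; blast)

lemma dba_ideal_dual_dba: "dba_ideal (dual_dba D) F \<longleftrightarrow> dba_filter D F"
  unfolding dba_filter_def dba_ideal_def using dle_dual_dba by (auto; blast)

lemma primary_filters_dual_dba: "primary_filters (dual_dba D) = primary_ideals D"
  by (simp add: primary_filters_def primary_ideals_def dba_filter_dual_dba)

lemma primary_ideals_dual_dba: "primary_ideals (dual_dba D) = primary_filters D"
  by (simp add: primary_filters_def primary_ideals_def dba_ideal_dual_dba)

lemma filters_at_dual_dba: "filters_at (dual_dba D) = ideals_at D"
  by (simp add: fun_eq_iff filters_at_def ideals_at_def primary_filters_dual_dba)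

text \<open>Separation applied to the principal filter of \<open>x\<close>. It misses
  \<open>I\<close> because, \<open>x\<close> being meet-idempotent, \<open>x \<preceq> y\<close>
  with \<open>y \<in> I\<close> would force \<open>x \<in> I\<close>.\<close>

lemma primary_filter_disjoint_ideal:
  assumes I: "I \<in> primary_ideals D" and x: "x \<in> meet_part D" "x \<notin> I"
  obtains F where "F \<in> primary_filters D" "x \<in> F" "F \<inter> I = {}"
proof -
  have xc: "x \<in> carrier D" "x \<sqinter> x = x" using x by (auto simp: meet_part_def)
  have idl: "dba_ideal D I" using I by (simp add: primary_ideals_def)
  have Ic: "I \<subseteq> carrier D" using idl by (simp add: dba_ideal_def)
  have down: "y \<in> I" if "z \<in> I" "y \<preceq> z" "y \<sqinter> y = y" "y \<in> carrier D" for y z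
    using idl that Ic dle_if_meet_le unfolding dba_ideal_def by blast
  obtain F where "F \<in> primary_filters D" "{y \<in> carrier D. x \<preceq> y} \<subseteq> F" "F \<inter> I = {}"
  proof (rule primary_filter_separation[OF dba_filter_principal[OF xc(1)] _ Ic])
    show "{y \<in> carrier D. x \<preceq> y} \<noteq> {}" using meet_le_refl xc by blast
    show "I \<noteq> {}" using I xc by (auto simp: primary_ideals_def)
    show "{y \<in> carrier D. x \<preceq> y} \<inter> I = {}" using down xc x by blast
    fix y z assume yz: "y \<in> I" "z \<in> I"
    then have c: "y \<in> carrier D" "z \<in> carrier D" using Ic by auto
    have "y \<squnion> z \<in> I" using idl yz by (simp add: dba_ideal_def)
    \<comment> \<open>\<open>y \<curlyvee> z\<close> is meet-idempotent, so lying
      \<open>\<preceq>\<close>-below a member of \<open>I\<close> is enough for membership.\<close>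
    moreover have "y \<curlyvee> z \<preceq> y \<squnion> z"
      using c by (auto intro!: vee_meet_leI meet_le_join_left meet_le_join_right)
    ultimately show "y \<curlyvee> z \<in> I" using down c vee_meet_self by auto
  qed
  then show thesis using that meet_le_refl xc by blast
qed

text \<open>Filter facts become ideal facts under the prefix \<open>dual\<close>, once the equations
  for \<open>dual_dba\<close> translate them back.\<close>

interpretation dual: double_boolean_algebra "dual_dba D"
  by (rule dual)

lemma primary_ideal_disjoint_filter:
  assumes "F \<in> primary_filters D" "x \<in> join_part D" "x \<notin> F"
  obtains I where "I \<in> primary_ideals D" "x \<in> I" "F \<inter> I = {}"
  using dual.primary_filter_disjoint_ideal[of F x] assms
  by (auto simp: primary_ideals_dual_dba primary_filters_dual_dba meet_part_dual_dba Int_commute)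

abbreviation ideal_space :: "'a set topology"
  where "ideal_space \<equiv> closed_subbase_topology (primary_ideals D) (ideals_at D ` carrier D)"

lemma clopenin_ideals_at: "x \<in> carrier D \<Longrightarrow> clopenin ideal_space (ideals_at D x)"
  using dual.clopenin_filters_at[of x]
  by (simp add: primary_filters_dual_dba filters_at_dual_dba)

lemma clopenin_ideal_spaceE:
  assumes "clopenin ideal_space B"
  obtains z where "z \<in> join_part D" "B = ideals_at D z"
  using dual.clopenin_filter_spaceE[of B] assms
  by (auto simp: primary_filters_dual_dba filters_at_dual_dba meet_part_dual_dba)

section \<open>Box and diamond in the primary context\<close>

text \<open>\<open>I\<close> lies in the box iff no primary filter disjoint from \<open>I\<close>
  contains \<open>x\<close>; if \<open>x \<notin> I\<close>, separation produces such a
  filter.\<close>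

lemma box_filters_at_neg:
  assumes x: "x \<in> meet_part D"
  shows "box (primary_context D) (filters_at D (\<sim> x)) = ideals_at D x"
proof -
  have xc: "x \<in> carrier D" using x by (simp add: meet_part_def)
  have "x \<in> I \<longleftrightarrow> (\<forall>F\<in>primary_filters D. F \<inter> I = {} \<longrightarrow> x \<notin> F)" if "I \<in> primary_ideals D" for I
    using primary_filter_disjoint_ideal[OF that x] by blast
  then show ?thesis
    unfolding box_def primary_context_def filters_at_neg[OF xc]
    by (auto simp: filters_at_def ideals_at_def)
qed

text \<open>\<open>F\<close> lies in the diamond iff some primary ideal disjoint from
  \<open>F\<close> contains \<open>x\<close>; separation provides one if
  \<open>x \<notin> F\<close>.\<close>

lemma dia_ideals_at:
  assumes x: "x \<in> join_part D"
  shows "dia (primary_context D) (ideals_at D x) = filters_at D (\<sim> x)"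
proof -
  have xc: "x \<in> carrier D" using x by (simp add: join_part_def)
  have "x \<notin> F \<longleftrightarrow> (\<exists>I\<in>primary_ideals D. F \<inter> I = {} \<and> x \<in> I)" if "F \<in> primary_filters D" for F
    using primary_ideal_disjoint_filter[OF that x] by blast
  then show ?thesis
    unfolding dia_def primary_context_def filters_at_neg[OF xc]
    by (auto simp: filters_at_def ideals_at_def)
qed

section \<open>Idempotent clopen protoconcepts\<close>

lemma carrier_clopen_oo_protoconcepts_primary_context:
  "(A, B) \<in> carrier (clopen_oo_protoconcepts (primary_context D)) \<longleftrightarrow>
    clopenin filter_space A \<and> clopenin ideal_space B \<and>
    dia (primary_context D) (box (primary_context D) A) = dia (primary_context D) B"
proof -
  have "A \<subseteq> primary_filters D" if "clopenin filter_space A"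
    using that openin_subset by (fastforce simp: clopenin_def)
  moreover have "B \<subseteq> primary_ideals D" if "clopenin ideal_space B"
    using that openin_subset by (fastforce simp: clopenin_def)
  ultimately show ?thesis
    by (auto simp: clopen_oo_protoconcepts_def oo_protoconcept_def primary_context_def Let_def)
qed

lemma meet_part_primary_context_iff:
  "(A, B) \<in> meet_part (clopen_oo_protoconcepts (primary_context D)) \<longleftrightarrow>
    (\<exists>x\<in>meet_part D. (A, B) = (filters_at D (\<sim> x), ideals_at D x))" (is "?L \<longleftrightarrow> ?R")
proof
  assume ?L
  then have A: "clopenin filter_space A" and B: "B = box (primary_context D) A"
    by (auto simp: meet_part_clopen_oo_protoconcepts
        carrier_clopen_oo_protoconcepts_primary_context)
  obtain z where z: "z \<in> meet_part D" "A = filters_at D z"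
    using clopenin_filter_spaceE[OF A] .
  \<comment> \<open>The witness is \<open>\<sim> z\<close>, because \<open>A\<close> has to appear
    as the filters at the negation of the witness.\<close>
  then have "\<sim> z \<in> meet_part D" "\<sim> (\<sim> z) = z"
    by (auto simp: meet_part_def neg_meet_self neg_neg)
  then show ?R using z B box_filters_at_neg[of "\<sim> z"] by (intro bexI[of _ "\<sim> z"]) auto
next
  assume ?R
  then obtain x where x: "x \<in> meet_part D" "A = filters_at D (\<sim> x)" "B = ideals_at D x" by auto
  then have "x \<in> carrier D" by (simp add: meet_part_def)
  with x show ?L
    by (simp add: meet_part_clopen_oo_protoconcepts box_filters_at_neg clopenin_filters_at
        clopenin_ideals_at carrier_clopen_oo_protoconcepts_primary_context)
qed

lemma join_part_primary_context_iff:
  "(A, B) \<in> join_part (clopen_oo_protoconcepts (primary_context D)) \<longleftrightarrow>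
    (\<exists>x\<in>join_part D. (A, B) = (filters_at D (\<sim> x), ideals_at D x))" (is "?L \<longleftrightarrow> ?R")
proof
  assume ?L
  then have "clopenin ideal_space B" and A: "A = dia (primary_context D) B"
    by (auto simp: join_part_clopen_oo_protoconcepts
        carrier_clopen_oo_protoconcepts_primary_context)
  then obtain z where "z \<in> join_part D" "B = ideals_at D z"
    using clopenin_ideal_spaceE by blast
  \<comment> \<open>Here \<open>B\<close> determines the pair, so its index \<open>z\<close> is
    itself the witness.\<close>
  then show ?R using A dia_ideals_at by auto
next
  assume ?R
  then obtain x where x: "x \<in> join_part D" "A = filters_at D (\<sim> x)" "B = ideals_at D x" by auto
  then have "x \<in> carrier D" by (simp add: join_part_def)
  moreover have A: "A = dia (primary_context D) B" using x dia_ideals_at by simp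
  \<comment> \<open>As \<open>A\<close> is a diamond, the triangle identity gives the protoconcept
    condition.\<close>
  moreover have "dia (primary_context D) (box (primary_context D) A) = A"
    unfolding A by (rule dia_box_dia) (auto simp: primary_context_def)
  moreover have "clopenin filter_space A" "clopenin ideal_space B"
    using x \<open>x \<in> carrier D\<close> by (simp_all add: clopenin_filters_at clopenin_ideals_at)
  ultimately show ?L
    by (simp add: join_part_clopen_oo_protoconcepts
        carrier_clopen_oo_protoconcepts_primary_context)
qed

end

theorem mainTheorem14:
  fixes D :: "('a, 'b) dba_alg_scheme"
    and A B :: "'a set set"
  assumes "double_boolean_algebra D"
    and "A \<subseteq> primary_filters D"
    and "B \<subseteq> primary_ideals D"
  shows "((A, B) \<in> pure_part (clopen_oo_protoconcepts (primary_context D)) \<longleftrightarrow>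
           (\<exists>x\<in>pure_part D. (A, B) = (filters_at D (\<sim>\<^bsub>D\<^esub> x), ideals_at D x)))
       \<and> ((A, B) \<in> meet_part (clopen_oo_protoconcepts (primary_context D)) \<longrightarrow>
           (\<exists>x\<in>meet_part D. (A, B) = (filters_at D (\<sim>\<^bsub>D\<^esub> x), ideals_at D x)))
       \<and> ((A, B) \<in> join_part (clopen_oo_protoconcepts (primary_context D)) \<longrightarrow>
           (\<exists>x\<in>join_part D. (A, B) = (filters_at D (\<sim>\<^bsub>D\<^esub> x), ideals_at D x)))"
proof -
  interpret double_boolean_algebra D by (rule assms(1))
  \<comment> \<open>\<open>pure_part\<close> is a union on both sides, so the first claim is the
    disjunction of the two characterizations.\<close>
  show ?thesis
    unfolding pure_part_def Un_iff bex_Un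
      meet_part_primary_context_iff join_part_primary_context_iff by simp
qed

end
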